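(* Let $\mathcal{G}$ be a set of $n$-qubit Pauli strings. If $\mathfrak{g}=\mathrm{span}_{i\mathbb{R}}(\mathcal{G})$ is a simple Lie algebra, then all nodes in the frustration graph of any Hamiltonian of the form $H=\sum_{p\in\mathcal{G}}c_p\,p$ have the same degree.
   Context: A Pauli string is an operator $\sigma_1\otimes\cdots\otimes\sigma_n$ on $(\mathbb C^2)^{\otimes n}$ with each $\sigma_i\in\{I,X,Y,Z\}$. $\mathrm{span}_{i\mathbb R}(\mathcal G)$ is the real linear span of $\{ip:p\in\mathcal G\}$; the hypothesis is that this real vector space is closed under the matrix commutator and is a simple Lie algebra. The frustration graph of $H=\sum_{p\in\mathcal{G}}c_p p$ has one vertex for each Pauli string in the generating set $\mathcal{G}$, with an edge connecting two vertices iff the corresponding Pauli strings anticommute. *)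

theory Defs
  imports "HOL-Analysis.Analysis" "Graph_Theory.Digraph"
begin

section \<open>Pauli strings\<close>

text \<open>The computational basis of \<open>(\<complex>\<^sup>2)\<^sup>\<otimes>\<^sup>n\<close> is indexed by the functions from the set of qubits,
  the index type \<open>'n\<close> with \<open>CARD('n) = n\<close>, to the two-element type \<open>2\<close>. Operators are complex
  matrices with respect to this basis.\<close>

type_synonym 'n qubit_op = "complex ^ ('n \<Rightarrow> 2) ^ ('n \<Rightarrow> 2)"

definition pauli_X :: "complex ^ 2 ^ 2" where
  "pauli_X = vector [vector [0, 1], vector [1, 0]]"

definition pauli_Y :: "complex ^ 2 ^ 2" where
  "pauli_Y = vector [vector [0, - \<i>], vector [\<i>, 0]]"

definition pauli_Z :: "complex ^ 2 ^ 2" where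
  "pauli_Z = vector [vector [1, 0], vector [0, - 1]]"

definition pauli_matrices :: "(complex ^ 2 ^ 2) set" where
  "pauli_matrices = {mat 1, pauli_X, pauli_Y, pauli_Z}"

text \<open>The tensor product of the single-qubit operators \<open>\<sigma> i\<close>: its matrix entries are the products
  of the entries of the factors.\<close>

definition tensor_op :: "('n::finite \<Rightarrow> complex ^ 2 ^ 2) \<Rightarrow> 'n qubit_op" where
  "tensor_op \<sigma> = (\<chi> a b. \<Prod>i\<in>UNIV. \<sigma> i $ a i $ b i)"

definition pauli_strings :: "('n::finite) qubit_op set" where
  "pauli_strings = {tensor_op \<sigma> | \<sigma>. \<forall>i. \<sigma> i \<in> pauli_matrices}"

definition anticommute :: "complex ^ 'm::finite ^ 'm \<Rightarrow> complex ^ 'm ^ 'm \<Rightarrow> bool" where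
  "anticommute p q \<longleftrightarrow> p ** q = - (q ** p)"


section \<open>Real Lie algebras of complex matrices\<close>

text \<open>\<^const>\<open>subspace\<close> and \<^const>\<open>span\<close> refer to the real vector space structure.\<close>

definition commutator :: "complex ^ 'm::finite ^ 'm \<Rightarrow> complex ^ 'm ^ 'm \<Rightarrow> complex ^ 'm ^ 'm" where
  "commutator x y = x ** y - y ** x"

definition lie_algebra :: "(complex ^ 'm::finite ^ 'm) set \<Rightarrow> bool" where
  "lie_algebra L \<longleftrightarrow> subspace L \<and> (\<forall>x\<in>L. \<forall>y\<in>L. commutator x y \<in> L)"

definition lie_ideal :: "(complex ^ 'm::finite ^ 'm) set \<Rightarrow> (complex ^ 'm ^ 'm) set \<Rightarrow> bool" where
  "lie_ideal J L \<longleftrightarrow> subspace J \<and> J \<subseteq> L \<and> (\<forall>x\<in>L. \<forall>y\<in>J. commutator x y \<in> J)"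

definition simple_lie_algebra :: "(complex ^ 'm::finite ^ 'm) set \<Rightarrow> bool" where
  "simple_lie_algebra L \<longleftrightarrow>
     lie_algebra L \<and> (\<exists>x\<in>L. \<exists>y\<in>L. commutator x y \<noteq> 0) \<and> (\<forall>J. lie_ideal J L \<longrightarrow> J = {0} \<or> J = L)"

definition i_mult :: "complex ^ 'm::finite ^ 'm \<Rightarrow> complex ^ 'm ^ 'm" where
  "i_mult p = (\<chi> a b. \<i> * p $ a $ b)"

definition span_iR :: "(complex ^ 'm::finite ^ 'm) set \<Rightarrow> (complex ^ 'm ^ 'm) set" where
  "span_iR G = span (i_mult ` G)"


section \<open>Frustration graphs\<close>

text \<open>Undirected graphs are symmetric digraphs, so each edge contributes one arc in either direction
  and the degree of a vertex is its \<^const>\<open>out_degree\<close>. The vertices are all elements of the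
  generating set \<open>G\<close>: the frustration graph of \<open>\<Sum>p\<in>G. c p *\<^sub>R p\<close> does not depend on the
  coefficients, some of which may vanish.\<close>

definition frustration_graph ::
    "(complex ^ 'm::finite ^ 'm) set \<Rightarrow> (complex ^ 'm ^ 'm, (complex ^ 'm ^ 'm) \<times> (complex ^ 'm ^ 'm)) pre_digraph" where
  "frustration_graph G =
     \<lparr>verts = G, arcs = {(p, q). p \<in> G \<and> q \<in> G \<and> anticommute p q}, tail = fst, head = snd\<rparr>"

lemma finite_pauli_strings: "finite (pauli_strings :: ('n::finite) qubit_op set)"
proof -
  have "finite (PiE UNIV (\<lambda>_::'n. pauli_matrices))"
    by (intro finite_PiE) (auto simp: pauli_matrices_def)
  moreover have "(pauli_strings :: 'n qubit_op set) \<subseteq> tensor_op ` (PiE UNIV (\<lambda>_::'n. pauli_matrices))"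
    by (auto simp: pauli_strings_def)
  ultimately show ?thesis
    by (blast intro: finite_subset)
qed

lemma pauli_matrix_square: "s \<in> pauli_matrices \<Longrightarrow> s ** s = mat 1"
  by (auto simp: pauli_matrices_def pauli_X_def pauli_Y_def pauli_Z_def mat_def vec_eq_iff
      matrix_matrix_mult_def forall_2 sum_2)

lemma tensor_op_mult: "tensor_op \<sigma> ** tensor_op \<tau> = tensor_op (\<lambda>i. \<sigma> i ** \<tau> i)"
proof -
  have "(\<Sum>k\<in>UNIV. (\<Prod>i\<in>UNIV. \<sigma> i $ a i $ k i) * (\<Prod>i\<in>UNIV. \<tau> i $ k i $ b i))
      = (\<Prod>i\<in>UNIV. \<Sum>k\<in>UNIV. \<sigma> i $ a i $ k * \<tau> i $ k $ b i)" for a b :: "'a \<Rightarrow> 2"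
    by (subst prod_sum_PiE) (auto simp: PiE_UNIV_domain prod.distrib)
  then show ?thesis
    by (simp add: tensor_op_def matrix_matrix_mult_def vec_eq_iff)
qed

lemma pauli_string_square:
  assumes "p \<in> pauli_strings" shows "p ** p = mat 1"
proof -
  obtain \<sigma> where \<sigma>: "p = tensor_op \<sigma>" "\<forall>i. \<sigma> i \<in> pauli_matrices"
    using assms by (auto simp: pauli_strings_def)
  then have "p ** p = tensor_op (\<lambda>i. mat 1)"
    by (simp add: tensor_op_mult pauli_matrix_square)
  also have "\<dots> = mat 1"
    by (auto simp: tensor_op_def mat_def vec_eq_iff fun_eq_iff)
  finally show ?thesis .
qed

lemma graph_frustration_graph:
  assumes "G \<subseteq> (pauli_strings :: ('n::finite) qubit_op set)"
  shows "graph (frustration_graph G)"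
proof -
  have fin: "finite G"
    using assms finite_pauli_strings by (rule finite_subset)
  have fin': "finite {(p, q). p \<in> G \<and> q \<in> G \<and> anticommute p q}"
    by (rule finite_subset[OF _ finite_cartesian_product[OF fin fin]]) auto
  have irrefl: "\<not> anticommute p p" if "p \<in> G" for p
  proof
    assume "anticommute p p"
    moreover have "p ** p = mat 1"
      using that assms pauli_string_square by blast
    ultimately have "(mat 1 :: 'n qubit_op) = - mat 1"
      by (simp add: anticommute_def)
    then show False
      by (auto simp: vec_eq_iff mat_def split: if_splits)
  qed
  have comm: "anticommute p q \<Longrightarrow> anticommute q p" for p q :: "'n qubit_op"
    by (simp add: anticommute_def)
  show ?thesis
    by unfold_locales
       (auto simp: frustration_graph_def fin fin' irrefl arc_to_ends_def symmetric_def arcs_ends_def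
         intro!: symI dest: comm)
qed

lemma out_degree_frustration_graph:
  assumes "p \<in> G"
  shows "out_degree (frustration_graph G) p = card {q \<in> G. anticommute p q}"
proof -
  have "out_arcs (frustration_graph G) p = Pair p ` {q \<in> G. anticommute p q}"
    using assms by (auto simp: out_arcs_def frustration_graph_def)
  then show ?thesis
    by (simp add: out_degree_def card_image inj_on_def)
qed

end

theory Submission
  imports Defs
begin

text \<open>If \<open>p, q \<in> G\<close> anticommute, closure under the commutator and linear independence of
  the Pauli strings put \<open>p q\<close> into \<open>G\<close> up to a phase. Multiplication by \<open>p q\<close> then exchanges,
  up to signs, the elements of \<open>G\<close> that anticommute with \<open>p\<close> but not with \<open>q\<close> and those that
  anticommute with \<open>q\<close> but not with \<open>p\<close>, so adjacent vertices have equal degree. A nonzero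
  commutator of \<open>x, q \<in> G\<close> is a multiple of an element of \<open>G\<close> that anticommutes with \<open>q\<close>; hence
  the vertices of a given degree span an ideal, which by simplicity is everything.\<close>

section \<open>Complex scalars, commutators and anticommutation\<close>

text \<open>Products of Pauli strings carry phases such as \<i>, whereas \<open>*\<^sub>R\<close>
  scales by real numbers only.\<close>

definition cscale :: "complex \<Rightarrow> complex ^ 'm::finite ^ 'm \<Rightarrow> complex ^ 'm ^ 'm" where
  "cscale c A = (\<chi> a b. c * A $ a $ b)"

lemma i_mult_eq_cscale: "i_mult p = cscale \<i> p"
  by (simp add: i_mult_def cscale_def)

lemma cscale_1 [simp]: "cscale 1 A = A"
  by (simp add: cscale_def vec_eq_iff)

lemma cscale_minus_left: "cscale (- c) A = - cscale c A"
  by (simp add: cscale_def vec_eq_iff)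

lemma cscale_minus_right: "cscale c (- A) = - cscale c A"
  by (simp add: cscale_def vec_eq_iff)

lemma cscale_cscale [simp]: "cscale c (cscale d A) = cscale (c * d) A"
  by (simp add: cscale_def vec_eq_iff mult.assoc)

lemma cscale_mult: "cscale c A ** cscale d B = cscale (c * d) (A ** B)"
  by (simp add: cscale_def vec_eq_iff matrix_matrix_mult_def sum_distrib_left ac_simps)

lemma matrix_mult_minus_left: "(- A) ** B = - (A ** (B :: complex ^ 'm::finite ^ 'm))"
  by (simp add: vec_eq_iff matrix_matrix_mult_def sum_negf)

lemma matrix_mult_minus_right: "A ** (- B) = - (A ** (B :: complex ^ 'm::finite ^ 'm))"
  by (simp add: vec_eq_iff matrix_matrix_mult_def sum_negf)

lemma cscale_mat_1_eq_iff: "cscale c (mat 1 :: complex ^ 'm::finite ^ 'm) = cscale d (mat 1) \<longleftrightarrow> c = d"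
  by (auto simp: cscale_def mat_def vec_eq_iff)

lemma i_mult_mult: "i_mult p ** i_mult q = - (p ** q)"
  by (simp add: i_mult_eq_cscale cscale_mult cscale_minus_left)

lemma commutator_zero_left [simp]: "commutator 0 y = 0"
  and commutator_zero_right [simp]: "commutator x 0 = 0"
  by (simp_all add: commutator_def)

lemma commutator_add_left: "commutator (x + y) z = commutator x z + commutator y z"
  and commutator_add_right: "commutator z (x + y) = commutator z x + commutator z y"
  by (simp_all add: commutator_def vec_eq_iff matrix_matrix_mult_def algebra_simps sum.distrib)

lemma commutator_scaleR_left: "commutator (r *\<^sub>R x) z = r *\<^sub>R commutator x z"
  and commutator_scaleR_right: "commutator z (r *\<^sub>R x) = r *\<^sub>R commutator z x"
  by (simp_all add: commutator_def vec_eq_iff matrix_matrix_mult_def scaleR_sum_right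
      scaleR_diff_right)

lemma commutator_i_mult_anticommute:
  assumes "anticommute p q"
  shows "commutator (i_mult p) (i_mult q) = (- 2) *\<^sub>R (p ** q)"
  using assms by (simp add: commutator_def anticommute_def i_mult_mult scaleR_2)

lemma anticommute_sym: "anticommute p q \<Longrightarrow> anticommute q p"
  by (simp add: anticommute_def)

text \<open>Anticommutation ignores signs and, by the analogous rule for \<open>i_mult\<close>,
  factors \<i>. It therefore passes from a product such as \<open>p ** q\<close> to the Pauli string
  that it equals up to a phase.\<close>

lemma anticommute_minus_left [simp]: "anticommute (- p) q \<longleftrightarrow> anticommute p q"
  unfolding anticommute_def matrix_mult_minus_left matrix_mult_minus_right
  by (metis minus_minus)

lemma anticommute_i_mult_left [simp]: "anticommute (i_mult p) q \<longleftrightarrow> anticommute p q"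
proof -
  have "i_mult p ** q = cscale \<i> (p ** q)" "q ** i_mult p = cscale \<i> (q ** p)"
    using cscale_mult[of \<i> p 1 q] cscale_mult[of 1 q \<i> p] by (simp_all add: i_mult_eq_cscale)
  moreover have "cscale \<i> A = cscale \<i> B \<longleftrightarrow> A = B" for A B :: "complex ^ 'a ^ 'a"
    by (simp add: cscale_def vec_eq_iff)
  ultimately show ?thesis
    by (simp add: anticommute_def flip: cscale_minus_right)
qed

text \<open>Bilinearity: induction over one span and then the other reduces closure of a subspace
  under commutators to generators.\<close>

lemma commutator_span_mem:
  assumes x: "x \<in> span A" and y: "y \<in> span B" and J: "subspace J"
    and base: "\<And>a b. a \<in> A \<Longrightarrow> b \<in> B \<Longrightarrow> commutator a b \<in> J"
  shows "commutator x y \<in> J"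
proof -
  have *: "commutator a y \<in> J" if "a \<in> A" for a
    using y
  proof (induction rule: span_induct)
    case base
    show ?case
      using J by (auto simp: subspace_def commutator_add_right commutator_scaleR_right)
  qed (use that base in auto)
  show ?thesis
    using x
  proof (induction rule: span_induct)
    case base
    show ?case
      using J by (auto simp: subspace_def commutator_add_left commutator_scaleR_left)
  qed (use * in auto)
qed


section \<open>The Pauli strings\<close>

lemma pauli_product_simps:
  "pauli_X ** pauli_X = mat 1" "pauli_Y ** pauli_Y = mat 1" "pauli_Z ** pauli_Z = mat 1"
  "pauli_X ** pauli_Y = cscale \<i> pauli_Z" "pauli_Y ** pauli_X = cscale (- \<i>) pauli_Z"
  "pauli_Y ** pauli_Z = cscale \<i> pauli_X" "pauli_Z ** pauli_Y = cscale (- \<i>) pauli_X"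
  "pauli_Z ** pauli_X = cscale \<i> pauli_Y" "pauli_X ** pauli_Z = cscale (- \<i>) pauli_Y"
  by (simp_all add: pauli_X_def pauli_Y_def pauli_Z_def mat_def vec_eq_iff
      matrix_matrix_mult_def forall_2 sum_2 cscale_def)

lemma pauli_matrix_mult:
  assumes "s \<in> pauli_matrices" "t \<in> pauli_matrices"
  shows "\<exists>c. \<exists>u\<in>pauli_matrices. s ** t = cscale c u"
proof -
  have "\<exists>c\<in>{1, \<i>, - \<i>}. s ** t \<in> cscale c ` pauli_matrices"
    using assms by (auto simp: pauli_matrices_def pauli_product_simps)
  then show ?thesis
    by blast
qed

lemma pauli_matrix_swap:
  assumes "s \<in> pauli_matrices" "t \<in> pauli_matrices"
  shows "\<exists>c\<in>{1, - 1}. t ** s = cscale c (s ** t)"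
  using assms
  by (auto simp: pauli_matrices_def pauli_X_def pauli_Y_def pauli_Z_def mat_def vec_eq_iff
      matrix_matrix_mult_def forall_2 sum_2 cscale_def)

text \<open>The double sum is the Hilbert-Schmidt product, the trace of the adjoint of
  \<open>s\<close> times \<open>t\<close>.\<close>

lemma pauli_matrix_orthogonal:
  assumes "s \<in> pauli_matrices" "t \<in> pauli_matrices" "s \<noteq> t"
  shows "(\<Sum>a\<in>UNIV. \<Sum>b\<in>UNIV. cnj (s $ a $ b) * t $ a $ b) = 0"
  using assms
  by (auto simp: pauli_matrices_def pauli_X_def pauli_Y_def pauli_Z_def mat_def vec_eq_iff
      forall_2 sum_2)

lemma tensor_op_cscale: "tensor_op (\<lambda>i. cscale (c i) (\<sigma> i)) = cscale (\<Prod>i\<in>UNIV. c i) (tensor_op \<sigma>)"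
  by (simp add: tensor_op_def cscale_def vec_eq_iff prod.distrib)

text \<open>The real inner product of matrices is the real part of the Hilbert-Schmidt product, and
  the latter is multiplicative over tensor factors.\<close>

lemma inner_tensor_op:
  "tensor_op \<sigma> \<bullet> tensor_op \<tau>
   = Re (\<Prod>i\<in>UNIV. \<Sum>a\<in>UNIV. \<Sum>b\<in>UNIV. cnj (\<sigma> i $ a $ b) * \<tau> i $ a $ b)"
proof -
  \<comment> \<open>Distributivity: choosing one summand in every factor amounts to choosing a basis
    index \<open>a\<close>.\<close>
  have prod_sum: "(\<Prod>i\<in>UNIV. \<Sum>k\<in>UNIV. f i k) = (\<Sum>a\<in>UNIV. \<Prod>i\<in>UNIV. f i (a i))"
    for f :: "'a \<Rightarrow> 2 \<Rightarrow> complex"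
    by (subst prod_sum_PiE) (auto simp: PiE_UNIV_domain)
  have inner: "x \<bullet> y = Re (cnj x * y)" for x y :: complex
    by (simp add: inner_complex_def)
  have "tensor_op \<sigma> \<bullet> tensor_op \<tau> = (\<Sum>a\<in>UNIV. \<Sum>b\<in>UNIV.
      (\<Prod>i\<in>UNIV. \<sigma> i $ a i $ b i) \<bullet> (\<Prod>i\<in>UNIV. \<tau> i $ a i $ b i))"
    by (simp add: inner_vec_def tensor_op_def)
  also have "\<dots> = Re (\<Sum>a\<in>UNIV. \<Sum>b\<in>UNIV. \<Prod>i\<in>UNIV. cnj (\<sigma> i $ a i $ b i) * \<tau> i $ a i $ b i)"
    by (simp only: inner Re_sum cnj_prod prod.distrib)
  also have "\<dots> = Re (\<Prod>i\<in>UNIV. \<Sum>a\<in>UNIV. \<Sum>b\<in>UNIV. cnj (\<sigma> i $ a $ b) * \<tau> i $ a $ b)"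
    by (simp only: prod_sum)
  finally show ?thesis .
qed

text \<open>A single qubit at which the factors differ already makes the product of the single-qubit
  inner products vanish.\<close>

lemma pauli_string_orthogonal:
  assumes "p \<in> pauli_strings" "q \<in> pauli_strings" "p \<noteq> q"
  shows "p \<bullet> q = 0"
proof -
  obtain \<sigma> \<tau> where \<sigma>: "p = tensor_op \<sigma>" "\<And>i. \<sigma> i \<in> pauli_matrices"
    and \<tau>: "q = tensor_op \<tau>" "\<And>i. \<tau> i \<in> pauli_matrices"
    using assms by (auto simp: pauli_strings_def)
  have "\<sigma> \<noteq> \<tau>"
    using assms(3) \<sigma>(1) \<tau>(1) by auto
  then obtain i where "\<sigma> i \<noteq> \<tau> i"
    by (auto simp: fun_eq_iff)
  then have "(\<Sum>a\<in>UNIV. \<Sum>b\<in>UNIV. cnj (\<sigma> i $ a $ b) * \<tau> i $ a $ b) = 0"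
    using \<sigma> \<tau> pauli_matrix_orthogonal by blast
  then have "(\<Prod>i\<in>UNIV. \<Sum>a\<in>UNIV. \<Sum>b\<in>UNIV. cnj (\<sigma> i $ a $ b) * \<tau> i $ a $ b) = 0"
    by (intro prod_zero) auto
  then show ?thesis
    by (simp only: \<sigma>(1) \<tau>(1) inner_tensor_op zero_complex.sel)
qed

lemma pauli_string_nonzero:
  assumes "p \<in> (pauli_strings :: ('n::finite) qubit_op set)"
  shows "p \<noteq> 0"
proof
  assume "p = 0"
  then have "(mat 1 :: 'n qubit_op) = 0"
    using pauli_string_square[OF assms] by simp
  then show False
    by (auto simp: mat_def vec_eq_iff split: if_splits)
qed

text \<open>Distinct strings are orthogonal, but a nonzero operator is not orthogonal to its
  negative. This removes the sign ambiguity in products.\<close>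

lemma pauli_string_eq_up_to_sign:
  assumes "p \<in> pauli_strings" "q \<in> pauli_strings" "p = q \<or> p = - q"
  shows "p = q"
proof (rule ccontr)
  assume "p \<noteq> q"
  then have "p \<bullet> q = 0" "p = - q"
    using pauli_string_orthogonal[OF assms(1,2)] assms(3) by blast+
  then show False
    using pauli_string_nonzero[OF assms(2)] by simp
qed

text \<open>Swapping the factors costs a sign at each qubit; the product of these signs is again 1
  or -1.\<close>

lemma pauli_string_swap:
  assumes "p \<in> pauli_strings" "q \<in> pauli_strings"
  shows "p ** q = q ** p \<or> anticommute p q"
proof -
  obtain \<sigma> \<tau> where \<sigma>: "p = tensor_op \<sigma>" "\<And>i. \<sigma> i \<in> pauli_matrices"
    and \<tau>: "q = tensor_op \<tau>" "\<And>i. \<tau> i \<in> pauli_matrices"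
    using assms by (auto simp: pauli_strings_def)
  have "\<forall>i. \<exists>c\<in>{1, - 1}. \<sigma> i ** \<tau> i = cscale c (\<tau> i ** \<sigma> i)"
    using \<sigma>(2) \<tau>(2) pauli_matrix_swap by blast
  then obtain c where c: "\<And>i. c i \<in> {1, - 1}" "\<And>i. \<sigma> i ** \<tau> i = cscale (c i) (\<tau> i ** \<sigma> i)"
    by metis
  have eq: "p ** q = cscale (prod c UNIV) (q ** p)"
    by (simp add: \<sigma>(1) \<tau>(1) tensor_op_mult c(2) tensor_op_cscale)
  have "c i ^ 2 = 1" for i
    using c(1)[of i] by auto
  then have "(prod c UNIV) ^ 2 = 1"
    by (simp add: prod_power_distrib)
  then have "prod c UNIV = 1 \<or> prod c UNIV = - 1"
    by (simp add: power2_eq_1_iff)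
  then show ?thesis
    using eq by (auto simp: anticommute_def cscale_minus_left)
qed

lemma pauli_string_mult_anticommute:
  assumes p: "p \<in> pauli_strings" and q: "q \<in> pauli_strings" and anti: "anticommute p q"
  shows "\<exists>t\<in>pauli_strings. p ** q = i_mult t \<or> p ** q = - i_mult t"
proof -
  obtain \<sigma> \<tau> where \<sigma>: "p = tensor_op \<sigma>" "\<And>i. \<sigma> i \<in> pauli_matrices"
    and \<tau>: "q = tensor_op \<tau>" "\<And>i. \<tau> i \<in> pauli_matrices"
    using assms by (auto simp: pauli_strings_def)
  have "\<forall>i. \<exists>c u. u \<in> pauli_matrices \<and> \<sigma> i ** \<tau> i = cscale c u"
    using \<sigma>(2) \<tau>(2) pauli_matrix_mult by blast
  then obtain c u where u: "\<And>i. u i \<in> pauli_matrices" "\<And>i. \<sigma> i ** \<tau> i = cscale (c i) (u i)"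
    by metis
  define z where "z = prod c UNIV"
  have eq: "p ** q = cscale z (tensor_op u)"
    by (simp add: \<sigma>(1) \<tau>(1) tensor_op_mult u(2) tensor_op_cscale z_def)
  have t: "tensor_op u \<in> pauli_strings"
    using u(1) by (auto simp: pauli_strings_def)
  \<comment> \<open>Only the phase \<open>z\<close> is still unknown. Anticommutation makes the
    square of \<open>p ** q\<close> equal to minus the identity, while \<open>tensor_op u\<close>
    squares to the identity, so \<open>z\<close> squares to -1.\<close>
  have "(p ** q) ** (p ** q) = - ((q ** p) ** (p ** q))"
    using anti by (simp add: anticommute_def matrix_mult_minus_left)
  also have "(q ** p) ** (p ** q) = q ** (p ** p) ** q"
    by (simp add: matrix_mul_assoc)
  also have "\<dots> = mat 1"
    using p q by (simp add: pauli_string_square)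
  finally have "cscale (z * z) (mat 1 :: 'a qubit_op) = cscale (- 1) (mat 1)"
    using t by (simp add: eq cscale_mult pauli_string_square cscale_minus_left)
  then have "z ^ 2 = \<i> ^ 2"
    by (simp add: cscale_mat_1_eq_iff power2_eq_square)
  then have "z = \<i> \<or> z = - \<i>"
    by (simp only: power2_eq_iff)
  then show ?thesis
    using t eq by (auto simp: i_mult_eq_cscale cscale_minus_left)
qed

section \<open>Linear independence over the reals\<close>

lemma i_mult_eq_iff: "i_mult p = i_mult q \<longleftrightarrow> p = q"
  by (simp add: i_mult_def vec_eq_iff)

lemma inner_i_mult: "i_mult p \<bullet> i_mult q = p \<bullet> q"
  by (simp add: i_mult_def inner_vec_def inner_complex_def add.commute)

lemma independent_i_mult_pauli_strings: "independent (i_mult ` pauli_strings)"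
proof (rule pairwise_orthogonal_independent)
  show "pairwise orthogonal (i_mult ` pauli_strings)"
    by (auto simp: pairwise_def orthogonal_def inner_i_mult i_mult_eq_iff pauli_string_orthogonal)
  show "0 \<notin> i_mult ` (pauli_strings :: 'a qubit_op set)"
    using pauli_string_nonzero by (force simp: i_mult_def vec_eq_iff)
qed

text \<open>If \<open>t\<close> were outside \<open>G\<close>, then \<open>i_mult t\<close> would
  depend linearly on other members of an independent family. Membership in the Lie algebra thus
  becomes membership in the generating set.\<close>

lemma i_mult_mem_span_iR_iff:
  assumes G: "G \<subseteq> pauli_strings" and t: "t \<in> pauli_strings"
  shows "i_mult t \<in> span_iR G \<longleftrightarrow> t \<in> G"
proof
  assume *: "i_mult t \<in> span_iR G"
  show "t \<in> G"
  proof (rule ccontr)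
    assume "t \<notin> G"
    then have "i_mult ` G \<subseteq> i_mult ` pauli_strings - {i_mult t}"
      using G by (auto simp: i_mult_eq_iff)
    then have "i_mult t \<in> span (i_mult ` pauli_strings - {i_mult t})"
      using * span_mono unfolding span_iR_def by blast
    then show False
      using independent_i_mult_pauli_strings t unfolding dependent_def by blast
  qed
qed (simp add: span_iR_def span_base)


section \<open>Degrees in the frustration graph\<close>

text \<open>The commutator of \<open>i_mult p\<close> and \<open>i_mult q\<close> is a real multiple
  of \<open>p ** q\<close>, so closure puts this product into the span, and independence then puts
  its Pauli string into \<open>G\<close>.\<close>

lemma pauli_lie_algebra_mult:
  assumes G: "G \<subseteq> pauli_strings" and L: "lie_algebra (span_iR G)"
    and p: "p \<in> G" and q: "q \<in> G" and anti: "anticommute p q"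
  shows "\<exists>t\<in>G. p ** q = i_mult t \<or> p ** q = - i_mult t"
proof -
  obtain t where t: "t \<in> pauli_strings" and pq: "p ** q = i_mult t \<or> p ** q = - i_mult t"
    using pauli_string_mult_anticommute G p q anti by blast
  have "i_mult p \<in> span_iR G" "i_mult q \<in> span_iR G"
    using p q by (auto simp: span_iR_def span_base)
  then have "(- 2) *\<^sub>R (p ** q) \<in> span_iR G"
    using L commutator_i_mult_anticommute[OF anti] unfolding lie_algebra_def by metis
  \<comment> \<open>The scalar undoes the factor -2 from the commutator.\<close>
  then have "(- 1 / 2) *\<^sub>R ((- 2) *\<^sub>R (p ** q)) \<in> span_iR G"
    unfolding span_iR_def by (rule span_scale)
  then have "p ** q \<in> span_iR G"
    by simp
  then have "i_mult t \<in> span_iR G"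
    using pq span_neg unfolding span_iR_def by fastforce
  then show ?thesis
    using i_mult_mem_span_iR_iff[OF G t] pq by blast
qed

text \<open>Left multiplication by \<open>p ** q\<close>, with signs dropped, injects the first set
  into the second.\<close>

lemma card_anticommute_diff_le:
  assumes G: "G \<subseteq> pauli_strings" and L: "lie_algebra (span_iR G)"
    and p: "p \<in> G" and q: "q \<in> G" and anti: "anticommute p q"
  shows "card {s \<in> G. anticommute p s \<and> \<not> anticommute q s}
       \<le> card {s \<in> G. anticommute q s \<and> \<not> anticommute p s}" (is "card ?A \<le> card ?B")
proof -
  obtain t where t: "t \<in> G" and pq: "p ** q = i_mult t \<or> p ** q = - i_mult t"
    using pauli_lie_algebra_mult[OF assms] by blast
  have qp: "q ** p = - (p ** q)"
    using anti by (simp add: anticommute_def)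
  have sq: "p ** p = mat 1" "q ** q = mat 1"
    using G p q pauli_string_square by blast+
  have ex: "\<exists>u\<in>?B. p ** q ** s = u \<or> p ** q ** s = - u" if s: "s \<in> ?A" for s
  proof -
    have ps: "s ** p = - (p ** s)"
      using s by (simp add: anticommute_def)
    have qs: "s ** q = q ** s"
      using s pauli_string_swap[of q s] G q by (simp add: subset_iff)
    \<comment> \<open>Moving \<open>s\<close> past \<open>p\<close> costs a sign, moving it past
      \<open>q\<close> does not.\<close>
    have "anticommute (p ** q) s"
    proof -
      have "s ** (p ** q) = - (p ** (s ** q))"
        by (simp add: matrix_mul_assoc ps matrix_mult_minus_left)
      then show ?thesis
        by (simp add: anticommute_def qs matrix_mul_assoc)
    qed
    then have "anticommute t s"
      using pq by auto
    then obtain u where u: "u \<in> G" and ts: "t ** s = i_mult u \<or> t ** s = - i_mult u"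
      using pauli_lie_algebra_mult[OF G L t] s by blast
    have its: "i_mult t ** s = cscale \<i> (t ** s)"
      using cscale_mult[of \<i> t 1 s] by (simp add: i_mult_eq_cscale)
    \<comment> \<open>One factor \<i> comes from \<open>p ** q\<close> and one from
      \<open>t ** s\<close>; together they leave only a sign, so \<open>p ** q ** s\<close> is
      \<open>u\<close> or \<open>- u\<close>.\<close>
    have "cscale \<i> (i_mult u) = - u"
      by (simp add: i_mult_eq_cscale cscale_minus_left)
    then have pqs: "p ** q ** s = u \<or> p ** q ** s = - u"
      using pq ts its by (auto simp: matrix_mult_minus_left cscale_minus_right)
    \<comment> \<open>Among the three factors, \<open>q\<close> picks up a sign only from
      \<open>p\<close>.\<close>
    have "q ** (p ** q ** s) = - (p ** q ** s) ** q"
    proof -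
      have "p ** q ** s ** q = p ** q ** (q ** s)"
        by (simp add: qs flip: matrix_mul_assoc)
      moreover have "q ** (p ** q ** s) = (q ** p) ** (q ** s)"
        by (simp add: matrix_mul_assoc)
      ultimately show ?thesis
        by (simp add: qp matrix_mult_minus_left)
    qed
    then have "anticommute (p ** q ** s) q"
      by (simp add: anticommute_def matrix_mult_minus_left)
    then have "anticommute q u"
      using pqs by (auto intro: anticommute_sym)
    \<comment> \<open>Passing \<open>q\<close> and \<open>s\<close> gives \<open>p\<close> two
      signs, which cancel. Anticommuting as well would force the product to vanish, and with it
      \<open>s\<close>, since \<open>p\<close> and \<open>q\<close> are invertible.\<close>
    moreover have "\<not> anticommute p u"
    proof
      assume "anticommute p u"
      then have "anticommute (p ** q ** s) p"
        using pqs by (auto intro: anticommute_sym)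
      moreover have "p ** q ** s ** p = p ** (p ** q ** s)"
      proof -
        have "p ** q ** s ** p = p ** q ** (s ** p)"
          by (simp add: matrix_mul_assoc)
        also have "\<dots> = - (p ** (q ** p) ** s)"
          by (simp add: ps matrix_mult_minus_right matrix_mul_assoc)
        also have "\<dots> = p ** (p ** q ** s)"
          by (simp add: qp matrix_mult_minus_left matrix_mult_minus_right matrix_mul_assoc)
        finally show ?thesis .
      qed
      ultimately have "p ** (p ** q ** s) = - (p ** (p ** q ** s))"
        by (simp add: anticommute_def)
      then have "p ** (p ** q ** s) = 0"
        by (simp add: vec_eq_iff)
      then have "q ** s = 0"
        by (simp add: matrix_mul_assoc sq)
      then have "q ** (q ** s) = 0"
        by simp
      then have "s = 0"
        by (simp add: matrix_mul_assoc sq)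
      then show False
        using s G pauli_string_nonzero by blast
    qed
    ultimately show ?thesis
      using u pqs by blast
  qed
  have "\<exists>f. \<forall>s\<in>?A. f s \<in> ?B \<and> (p ** q ** s = f s \<or> p ** q ** s = - f s)"
    by (rule bchoice) (use ex in blast)
  then obtain f where f: "\<And>s. s \<in> ?A \<Longrightarrow> f s \<in> ?B"
    "\<And>s. s \<in> ?A \<Longrightarrow> p ** q ** s = f s \<or> p ** q ** s = - f s"
    by blast
  \<comment> \<open>Since \<open>p\<close> and \<open>q\<close> are involutions,
    \<open>q ** p\<close> inverts \<open>p ** q\<close>; this recovers \<open>s\<close> from
    \<open>f s\<close> up to sign.\<close>
  have cancel: "q ** (p ** (p ** q ** s)) = s" for s
  proof -
    have "q ** (p ** (p ** q ** s)) = q ** (p ** p) ** q ** s"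
      by (simp add: matrix_mul_assoc)
    then show ?thesis
      by (simp add: sq)
  qed
  have "inj_on f ?A"
  proof (rule inj_onI)
    fix s s' assume s: "s \<in> ?A" and s': "s' \<in> ?A" and "f s = f s'"
    then have "p ** q ** s = p ** q ** s' \<or> p ** q ** s = - (p ** q ** s')"
      using f(2)[OF s] f(2)[OF s'] by auto
    then have "q ** (p ** (p ** q ** s)) = q ** (p ** (p ** q ** s'))
        \<or> q ** (p ** (p ** q ** s)) = - (q ** (p ** (p ** q ** s')))"
      by (elim disjE) (simp_all only: matrix_mult_minus_right simp_thms)
    then have "s = s' \<or> s = - s'"
      by (simp only: cancel)
    then show "s = s'"
      using s s' G pauli_string_eq_up_to_sign by blast
  qed
  moreover have "finite ?B"
    using finite_subset[OF G finite_pauli_strings] by simp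
  ultimately show ?thesis
    using f(1) by (intro card_inj_on_le) auto
qed

text \<open>Common neighbours count equally on both sides, and the private neighbours agree in
  number by the inequality applied to both orders of \<open>p\<close> and \<open>q\<close>.\<close>

lemma card_anticommute_eq:
  assumes G: "G \<subseteq> pauli_strings" and L: "lie_algebra (span_iR G)"
    and p: "p \<in> G" and q: "q \<in> G" and anti: "anticommute p q"
  shows "card {s \<in> G. anticommute p s} = card {s \<in> G. anticommute q s}"
proof -
  have fin: "finite G"
    using finite_subset[OF G finite_pauli_strings] .
  have split: "card {s \<in> G. anticommute x s} = card {s \<in> G. anticommute x s \<and> anticommute y s}
      + card {s \<in> G. anticommute x s \<and> \<not> anticommute y s}" for x y
    using fin by (subst card_Un_disjoint[symmetric]) (auto intro!: arg_cong[where f = card])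
  show ?thesis
    using card_anticommute_diff_le[OF G L p q anti]
      card_anticommute_diff_le[OF G L q p anticommute_sym[OF anti]]
      split[of p q] split[of q p] by (simp add: conj_commute)
qed

theorem corollary5:
  fixes G :: "('n::finite) qubit_op set"
    and c :: "'n qubit_op \<Rightarrow> real"
    and H :: "'n qubit_op"
  assumes "G \<subseteq> pauli_strings"
    and "simple_lie_algebra (span_iR G)"
    and "H = (\<Sum>p\<in>G. c p *\<^sub>R p)"
  shows "\<forall>p\<in>verts (frustration_graph G). \<forall>q\<in>verts (frustration_graph G).
           out_degree (frustration_graph G) p = out_degree (frustration_graph G) q"
proof -
  note G = assms(1)
  have L: "lie_algebra (span_iR G)"
    using assms(2) by (simp add: simple_lie_algebra_def)
  let ?deg = "\<lambda>p. card {s \<in> G. anticommute p s}"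
  have deg: "?deg p = ?deg q" if p: "p \<in> G" and q: "q \<in> G" for p q
  proof -
    \<comment> \<open>The degree class of \<open>p\<close>. It suffices that its span is an ideal:
      the span contains \<open>i_mult p\<close>, which rules out the zero ideal.\<close>
    define D where "D = {s \<in> G. ?deg s = ?deg p}"
    have DG: "D \<subseteq> G"
      by (auto simp: D_def)
    have J: "subspace (span_iR D)"
      by (simp add: span_iR_def)
    have "commutator x y \<in> span_iR D" if "x \<in> i_mult ` G" "y \<in> i_mult ` D" for x y
    proof -
      obtain g s where g: "g \<in> G" "x = i_mult g" and s: "s \<in> D" "y = i_mult s"
        using \<open>x \<in> i_mult ` G\<close> \<open>y \<in> i_mult ` D\<close> by blast
      have sG: "s \<in> G"
        using s DG by blast
      consider "g ** s = s ** g" | "anticommute g s"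
        using pauli_string_swap G g(1) sG by blast
      then show ?thesis
      proof cases
        case 1
        then have "commutator x y = 0"
          by (simp add: g s commutator_def i_mult_mult)
        then show ?thesis
          using J subspace_0 by simp
      next
        case 2
        then obtain t where t: "t \<in> G" and gs: "g ** s = i_mult t \<or> g ** s = - i_mult t"
          using pauli_lie_algebra_mult[OF G L g(1) sG] by blast
        \<comment> \<open>The product \<open>g ** s\<close> anticommutes with its own factor
          \<open>s\<close>, so \<open>t\<close> is a neighbour of \<open>s\<close> and has the same
          degree.\<close>
        have "s ** g = - (g ** s)"
          using anticommute_sym[OF 2] by (simp only: anticommute_def)
        then have "s ** (g ** s) = - (g ** s ** s)"
          by (simp add: matrix_mul_assoc matrix_mult_minus_left)
        then have "anticommute (g ** s) s"
          by (simp add: anticommute_def)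
        then have "anticommute t s"
          using gs by auto
        then have "t \<in> D"
          using card_anticommute_eq[OF G L t sG] s(1) t by (simp add: D_def)
        then have "i_mult t \<in> span_iR D"
          by (simp add: span_iR_def span_base)
        then have "g ** s \<in> span_iR D"
          using gs J subspace_neg by metis
        then show ?thesis
          using commutator_i_mult_anticommute[OF 2] J subspace_scale by (simp only: g s)
      qed
    qed
    then have "lie_ideal (span_iR D) (span_iR G)"
      using J commutator_span_mem[OF _ _ J] span_mono[OF image_mono[OF DG]]
      unfolding lie_ideal_def span_iR_def by blast
    then have "span_iR D = {0} \<or> span_iR D = span_iR G"
      using assms(2) by (simp add: simple_lie_algebra_def)
    moreover have "i_mult p \<in> span_iR D"
      using p by (simp add: D_def span_iR_def span_base)
    moreover have "i_mult p \<noteq> 0"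
      using pauli_string_nonzero[of p] G p by (auto simp: i_mult_def vec_eq_iff)
    ultimately have "span_iR D = span_iR G"
      by auto
    moreover have "i_mult q \<in> span_iR G"
      using q by (simp add: span_iR_def span_base)
    \<comment> \<open>Equality of the spans alone would not give equality of the generating sets;
      independence of the Pauli strings does.\<close>
    ultimately have "q \<in> D"
      using i_mult_mem_span_iR_iff[of D q] DG G q by auto
    then show ?thesis
      by (simp add: D_def)
  qed
  have "verts (frustration_graph G) = G"
    by (simp add: frustration_graph_def)
  then show ?thesis
    by (auto simp only: out_degree_frustration_graph intro: deg)
qed

end
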